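(* Let $\alpha<0$ be real, let $1\le\delta<\Delta$ be integers, and let $G$ be a graph with minimum degree $\delta$ and maximum degree $\Delta$. Then: (i) if $\delta$ is even, $M_1^\alpha(G)\ge\min\{\delta\Delta^{2\alpha}+(\Delta-\delta)(\Delta-1)^{2\alpha}+\delta^{2\alpha},\ (\Delta+1)\Delta^{2\alpha}+\delta^{2\alpha}\}$; (ii) if either $\delta$ is odd and $\Delta$ is even, or $\delta\Delta$ is odd and $2\Delta^{2\alpha}>(\Delta-1)^{2\alpha}$, then $M_1^\alpha(G)\ge\min\{\delta\Delta^{2\alpha}+(\Delta-\delta)(\Delta-1)^{2\alpha}+\delta^{2\alpha},\ \Delta^{2\alpha+1}+(\Delta-1)^{2\alpha}+\delta^{2\alpha}\}$; (iii) if $\delta\Delta$ is odd and $2\Delta^{2\alpha}\le(\Delta-1)^{2\alpha}$, then $M_1^\alpha(G)\ge\min\{\delta\Delta^{2\alpha}+(\Delta-\delta)(\Delta-1)^{2\alpha}+\delta^{2\alpha},\ (\Delta+2)\Delta^{2\alpha}+\delta^{2\alpha}\}$. These inequalities are sharp.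
   Context: All graphs are finite, simple and have at least one edge; $d_u$ is the degree of $u$. The first variable Zagreb index is $M_1^\alpha(G)=\sum_{u\in V(G)}d_u^{2\alpha}$. *)

theory Defs
  imports Complex_Main "Graph_Theory.Pair_Digraph"
begin

text \<open>
  A finite simple undirected graph is a \<^locale>\<open>pair_graph\<close>: an edge \<open>uv\<close> is
  the pair of opposite arcs \<open>(u, v)\<close> and \<open>(v, u)\<close>, so the degree of a vertex is its out-degree.
\<close>

definition nonempty_graph :: "'a pair_pre_digraph \<Rightarrow> bool" where
  "nonempty_graph G \<longleftrightarrow> pair_graph G \<and> parcs G \<noteq> {}"

definition vdegree :: "'a pair_pre_digraph \<Rightarrow> 'a \<Rightarrow> nat" where
  "vdegree G u = out_degree (with_proj G) u"

definition min_degree :: "'a pair_pre_digraph \<Rightarrow> nat" where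
  "min_degree G = Min (vdegree G ` pverts G)"

definition max_degree :: "'a pair_pre_digraph \<Rightarrow> nat" where
  "max_degree G = Max (vdegree G ` pverts G)"

text \<open>
  Isabelle has \<open>0 powr x = 0\<close>; with a negative exponent the index below is meaningful only for
  graphs without isolated vertices.
\<close>

definition first_variable_zagreb :: "real \<Rightarrow> 'a pair_pre_digraph \<Rightarrow> real" where
  "first_variable_zagreb \<alpha> G = (\<Sum>u\<in>pverts G. real (vdegree G u) powr (2 * \<alpha>))"

end

theory Submission
  imports Defs
begin

text \<open>
  If \<open>G\<close> has only \<open>\<Delta> + 1\<close> vertices, the \<open>\<Delta> - \<delta>\<close> vertices that are not adjacent to a vertex of
  degree \<open>\<delta>\<close> have degree at most \<open>\<Delta> - 1\<close>, which gives the first term of each minimum. With more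
  vertices, bound every other degree by \<open>\<Delta>\<close>; when \<open>\<delta>\<close> is odd, the handshake lemma often forbids all
  of them to equal \<open>\<Delta>\<close>, which gives the second term. The extremal graphs have \<open>\<Delta> + 1\<close>, \<open>\<Delta> + 2\<close> or
  \<open>\<Delta> + 3\<close> vertices, so their complements have all degrees at most 2 except at the vertex of
  degree \<open>\<delta>\<close>, and are easy to write down.
\<close>

section \<open>Degrees as cardinalities and the handshake lemma\<close>

lemma vdegree_eq_card: "vdegree G u = card {v. (u, v) \<in> parcs G}"
proof -
  have "out_arcs (with_proj G) u = Pair u ` {v. (u, v) \<in> parcs G}"
    by (auto simp: out_arcs_def)
  then show ?thesis
    unfolding vdegree_def out_degree_def by (simp add: card_image inj_on_def)
qed

text \<open>By irreflexivity \<open>(a, b)\<close> and \<open>(b, a)\<close> are distinct, and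
  deleting both leaves a smaller symmetric irreflexive relation, so elements disappear two at a
  time.\<close>

lemma even_card_sym_irrefl:
  assumes "finite R" "sym R" "irrefl R"
  shows "even (card R)"
  using assms
proof (induction R rule: finite_psubset_induct)
  case (psubset R)
  show ?case
  proof (cases "R = {}")
    case False
    then obtain a b where ab: "(a, b) \<in> R" by auto
    have ne: "a \<noteq> b" using ab psubset.prems by (auto simp: irrefl_def)
    have ba: "(b, a) \<in> R" using ab psubset.prems by (auto dest: symD)
    let ?S = "R - {(a, b), (b, a)}"
    have "even (card ?S)"
    proof (rule psubset.IH)
      show "?S \<subset> R" using ab by auto
      show "sym ?S" using psubset.prems(1) by (auto simp: sym_def)
      show "irrefl ?S" using psubset.prems(2) by (auto simp: irrefl_def)
    qed
    moreover have "card {(a, b), (b, a)} = 2" using ne by auto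
    then have "card R = card ?S + 2"
      using card_Diff_subset[of "{(a, b), (b, a)}" R] ab ba
        card_mono[of R "{(a, b), (b, a)}"] psubset.hyps by simp
    ultimately show ?thesis by simp
  qed simp
qed

text \<open>Handshake lemma: grouping the arcs by their tails shows that the degree sum is
  \<open>card (parcs G)\<close>, and the arcs form a symmetric irreflexive relation.\<close>

lemma even_sum_vdegree:
  assumes "pair_graph G"
  shows "even (\<Sum>u\<in>pverts G. vdegree G u)"
proof -
  interpret pair_graph G by fact
  have "parcs G = (SIGMA u:pverts G. {v. (u, v) \<in> parcs G})"
    by (auto dest: in_arcsD1)
  moreover have "finite {v. (u, v) \<in> parcs G}" for u
    by (rule finite_subset[OF _ pair_finite_verts]) (auto dest: in_arcsD2)
  ultimately have "card (parcs G) = (\<Sum>u\<in>pverts G. vdegree G u)"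
    using card_SigmaI[OF pair_finite_verts, of "\<lambda>u. {v. (u, v) \<in> parcs G}"]
    by (simp add: vdegree_eq_card)
  moreover have "sym (parcs G)"
    using pair_sym_arcs by (simp add: symmetric_def)
  moreover have "irrefl (parcs G)"
    using pair_no_loops by (fastforce simp: irrefl_def)
  ultimately show ?thesis
    using even_card_sym_irrefl[OF pair_finite_arcs] by simp
qed

lemma min_max_degree_witness:
  assumes "nonempty_graph G"
  obtains w z where "w \<in> pverts G" "vdegree G w = min_degree G"
    "z \<in> pverts G" "vdegree G z = max_degree G"
    "\<And>u. u \<in> pverts G \<Longrightarrow> min_degree G \<le> vdegree G u \<and> vdegree G u \<le> max_degree G"
proof -
  have "pair_graph G" "parcs G \<noteq> {}" using assms by (auto simp: nonempty_graph_def)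
  then interpret pair_graph G by simp
  let ?D = "vdegree G ` pverts G"
  have D: "finite ?D" "?D \<noteq> {}"
    using pair_finite_verts \<open>parcs G \<noteq> {}\<close> in_arcsD1 by auto
  obtain w where "w \<in> pverts G" "vdegree G w = min_degree G"
    using Min_in[OF D] unfolding min_degree_def by auto
  moreover obtain z where "z \<in> pverts G" "vdegree G z = max_degree G"
    using Max_in[OF D] unfolding max_degree_def by auto
  ultimately show thesis
    using that D by (auto simp: min_degree_def max_degree_def)
qed

section \<open>Lower bounds in terms of the number of vertices\<close>

context
  fixes \<alpha> :: real and \<delta> \<Delta> :: nat and G :: "'a pair_pre_digraph"
  assumes neg: "\<alpha> < 0" and pos: "1 \<le> \<delta>" and less: "\<delta> < \<Delta>"
    and ne: "nonempty_graph G" and min: "min_degree G = \<delta>" and max: "max_degree G = \<Delta>"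
begin

private abbreviation (input) f where "f k \<equiv> real k powr (2 * \<alpha>)"

text \<open>The exponent is negative, so a larger degree contributes less. Starting at 1 matters,
  because \<open>0 powr x = 0\<close>.\<close>

lemma f_antimono: "1 \<le> a \<Longrightarrow> a \<le> b \<Longrightarrow> f b \<le> f a"
  using neg by (intro powr_mono2') auto

lemma finite_pverts: "finite (pverts G)"
  using ne by (simp add: nonempty_graph_def pair_graph_def pair_digraph_def
      pair_fin_digraph_def pair_fin_digraph_axioms_def)

text \<open>A vertex of degree \<Delta> has \<Delta> neighbours besides itself. This leaves only the
  orders \<Delta> + 1 and at least \<Delta> + 2 to treat.\<close>

lemma max_degree_less_card: "\<Delta> < card (pverts G)"
proof -
  have "pair_graph G" using ne by (simp add: nonempty_graph_def)
  then interpret pair_graph G .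
  obtain z where z: "z \<in> pverts G" "vdegree G z = \<Delta>"
    using min_max_degree_witness[OF ne] min max by metis
  have "{v. (z, v) \<in> parcs G} \<subseteq> pverts G - {z}"
    using pair_no_loops by (fastforce dest: in_arcsD2)
  then have "\<Delta> \<le> card (pverts G - {z})"
    using z finite_pverts by (metis card_mono finite_Diff vdegree_eq_card)
  moreover have "card (pverts G) > 0"
    using z finite_pverts by (auto simp: card_gt_0_iff)
  ultimately show ?thesis using z finite_pverts by simp
qed

lemma zagreb_ge_card_eq:
  assumes card: "card (pverts G) = \<Delta> + 1"
  shows "first_variable_zagreb \<alpha> G
    \<ge> real \<delta> * f \<Delta> + (real \<Delta> - real \<delta>) * f (\<Delta> - 1) + f \<delta>"
proof -
  have "pair_graph G" using ne by (simp add: nonempty_graph_def)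
  then interpret pair_graph G .
  obtain w where w: "w \<in> pverts G" "vdegree G w = \<delta>"
    and bnd: "\<And>u. u \<in> pverts G \<Longrightarrow> \<delta> \<le> vdegree G u \<and> vdegree G u \<le> \<Delta>"
    using min_max_degree_witness[OF ne] min max by metis
  \<comment> \<open>The vertex set splits into \<open>w\<close>, its \<delta> neighbours
    \<open>?N\<close>, and the \<Delta> - \<delta> remaining vertices \<open>?R\<close>; one bound
    is used on each piece.\<close>
  let ?N = "{v. (w, v) \<in> parcs G}"
  let ?R = "pverts G - {w} - ?N"
  have N: "?N \<subseteq> pverts G - {w}"
    using pair_no_loops by (fastforce dest: in_arcsD2)
  have finN: "finite ?N" using N finite_pverts by (meson finite_Diff finite_subset)
  have cN: "card ?N = \<delta>" using w by (simp add: vdegree_eq_card)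
  have cR: "card ?R = \<Delta> - \<delta>"
    using card_Diff_subset[OF finN N] cN w finite_pverts card by simp
  have R_deg: "vdegree G u \<le> \<Delta> - 1" if u: "u \<in> ?R" for u
  proof -
    \<comment> \<open>By symmetry \<open>u\<close> misses \<open>w\<close> as well as itself, so
      only \<Delta> + 1 - 2 candidates are left for its neighbours.\<close>
    have "(u, w) \<notin> parcs G" using u pair_sym_arcs by (auto simp: symmetric_def dest: symD)
    then have "{v. (u, v) \<in> parcs G} \<subseteq> pverts G - {u, w}"
      using pair_no_loops by (fastforce dest: in_arcsD2)
    then have "vdegree G u \<le> card (pverts G - {u, w})"
      using finite_pverts by (simp add: vdegree_eq_card card_mono)
    also have "\<dots> = \<Delta> - 1"
      using u w card by (subst card_Diff_subset) auto
    finally show ?thesis .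
  qed
  have "f \<Delta> * \<delta> \<le> (\<Sum>u\<in>?N. f (vdegree G u))"
    using sum_bounded_below[of ?N "f \<Delta>" "\<lambda>u. f (vdegree G u)"] cN N bnd pos
    by (fastforce simp: mult.commute intro!: f_antimono)
  moreover have "f (\<Delta> - 1) * (\<Delta> - \<delta>) \<le> (\<Sum>u\<in>?R. f (vdegree G u))"
    using sum_bounded_below[of ?R "f (\<Delta> - 1)" "\<lambda>u. f (vdegree G u)"] cR bnd pos R_deg
    by (fastforce simp: mult.commute intro!: f_antimono intro: le_trans)
  moreover have "first_variable_zagreb \<alpha> G
      = f \<delta> + (\<Sum>u\<in>?N. f (vdegree G u)) + (\<Sum>u\<in>?R. f (vdegree G u))"
    using sum.remove[OF finite_pverts w(1), of "\<lambda>u. f (vdegree G u)"] w(2)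
      sum.subset_diff[OF N, of "\<lambda>u. f (vdegree G u)"] finite_pverts
    by (simp add: first_variable_zagreb_def)
  moreover have "real (\<Delta> - \<delta>) = real \<Delta> - real \<delta>" using less by simp
  ultimately show ?thesis by (simp add: mult.commute)
qed

text \<open>At least \<open>k\<close> vertices differ from the chosen vertex of degree \<delta>, and
  each contributes at least \<open>f \<Delta>\<close>; further vertices only add nonnegative
  terms.\<close>

lemma zagreb_ge_card:
  assumes "k < card (pverts G)"
  shows "first_variable_zagreb \<alpha> G \<ge> real k * f \<Delta> + f \<delta>"
proof -
  obtain w where w: "w \<in> pverts G" "vdegree G w = \<delta>"
    and bnd: "\<And>u. u \<in> pverts G \<Longrightarrow> \<delta> \<le> vdegree G u \<and> vdegree G u \<le> \<Delta>"
    using min_max_degree_witness[OF ne] min max by metis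
  have "real k * f \<Delta> \<le> real (card (pverts G - {w})) * f \<Delta>"
    using assms w finite_pverts by (intro mult_right_mono) auto
  also have "\<dots> \<le> (\<Sum>u\<in>pverts G - {w}. f (vdegree G u))"
    using bnd pos by (intro sum_bounded_below f_antimono) force+
  finally show ?thesis
    using sum.remove[OF finite_pverts w(1), of "\<lambda>u. f (vdegree G u)"] w(2)
    by (simp add: first_variable_zagreb_def)
qed

lemma zagreb_ge_parity:
  assumes k: "k + 1 < card (pverts G)" and "odd \<delta>" and even: "even \<Delta> \<or> odd (card (pverts G))"
  shows "first_variable_zagreb \<alpha> G \<ge> real k * f \<Delta> + f (\<Delta> - 1) + f \<delta>"
proof -
  obtain w where w: "w \<in> pverts G" "vdegree G w = \<delta>"
    and bnd: "\<And>u. u \<in> pverts G \<Longrightarrow> \<delta> \<le> vdegree G u \<and> vdegree G u \<le> \<Delta>"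
    using min_max_degree_witness[OF ne] min max by metis
  have "\<exists>x\<in>pverts G - {w}. vdegree G x \<noteq> \<Delta>"
  proof (rule ccontr)
    assume "\<not> ?thesis"
    then have "(\<Sum>u\<in>pverts G. vdegree G u) = \<delta> + (card (pverts G) - 1) * \<Delta>"
      using sum.remove[OF finite_pverts w(1), of "vdegree G"] w finite_pverts by simp
    moreover have "even (\<Sum>u\<in>pverts G. vdegree G u)"
      using even_sum_vdegree ne by (auto simp: nonempty_graph_def)
    \<comment> \<open>With \<delta> odd, an even degree sum forces the product
      \<open>(card (pverts G) - 1) * \<Delta>\<close> to be odd, hence both factors.\<close>
    ultimately have "odd (card (pverts G) - 1)" "odd \<Delta>"
      using \<open>odd \<delta>\<close> by auto
    with even show False by auto
  qed
  then obtain x where x: "x \<in> pverts G - {w}" "vdegree G x \<noteq> \<Delta>" by blast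
  have dx: "\<delta> \<le> vdegree G x" "vdegree G x \<le> \<Delta> - 1"
    using bnd[of x] x by auto
  \<comment> \<open>Removing \<open>w\<close> and the deficient vertex \<open>x\<close> still leaves
    at least \<open>k\<close> vertices, by the bound \<open>k + 1 < card (pverts G)\<close>.\<close>
  have "real k * f \<Delta> \<le> real (card (pverts G - {w} - {x})) * f \<Delta>"
    using assms w x finite_pverts by (intro mult_right_mono) auto
  also have "\<dots> \<le> (\<Sum>u\<in>pverts G - {w} - {x}. f (vdegree G u))"
    using bnd pos by (intro sum_bounded_below f_antimono) force+
  moreover have "f (\<Delta> - 1) \<le> f (vdegree G x)"
    using dx pos by (intro f_antimono) auto
  ultimately show ?thesis
    using sum.remove[OF finite_pverts w(1), of "\<lambda>u. f (vdegree G u)"] w(2)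
      sum.remove[OF _ x(1), of "\<lambda>u. f (vdegree G u)"] finite_pverts
    by (simp add: first_variable_zagreb_def)
qed

end

section \<open>Sharpness: extremal graphs described by their complements\<close>

definition realizes :: "nat pair_pre_digraph \<Rightarrow> nat \<Rightarrow> (nat \<Rightarrow> nat) \<Rightarrow> bool" where
  "realizes G n d \<longleftrightarrow> pair_graph G \<and> pverts G = {..<n} \<and> (\<forall>u<n. vdegree G u = d u)"

text \<open>\<open>N u\<close> is the neighbourhood of \<open>u\<close> in the complement, so
  \<open>u\<close> keeps \<open>n - 1 - card (N u)\<close> neighbours. The degree condition is
  written additively to avoid truncated subtraction.\<close>

lemma complement_realizes:
  fixes N :: "nat \<Rightarrow> nat set"
  assumes sub: "\<And>u. u < n \<Longrightarrow> N u \<subseteq> {..<n} - {u}"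
    and sym: "\<And>u v. u < n \<Longrightarrow> v \<in> N u \<Longrightarrow> u \<in> N v"
    and deg: "\<And>u. u < n \<Longrightarrow> d u + card (N u) + 1 = n"
  obtains G where "realizes G n d"
proof -
  let ?G = "\<lparr>pverts = {..<n}, parcs = {(u, v). u < n \<and> v < n \<and> u \<noteq> v \<and> v \<notin> N u}\<rparr>"
  have "finite (parcs ?G)"
    by (rule finite_subset[of _ "{..<n} \<times> {..<n}"]) auto
  then have "pair_graph ?G"
    by unfold_locales (auto simp: symmetric_def intro!: symI dest: sym)
  moreover have "vdegree ?G u = d u" if u: "u < n" for u
  proof -
    have "{v. (u, v) \<in> parcs ?G} = {..<n} - {u} - N u" using u by auto
    moreover have "finite (N u)" using sub[OF u] finite_subset by blast
    ultimately have "vdegree ?G u = n - 1 - card (N u)"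
      using sub[OF u] u by (simp add: vdegree_eq_card card_Diff_subset)
    with deg[OF u] show ?thesis by simp
  qed
  ultimately have "realizes ?G n d" by (simp add: realizes_def)
  then show thesis by (rule that)
qed

text \<open>Turns a realized degree sequence into a sharpness witness: \<open>a\<close> and
  \<open>b\<close> attain the extreme degrees, and \<delta> being positive supplies an edge at
  \<open>a\<close>.\<close>

lemma realizes_imp_exists:
  assumes G: "realizes G n d" and "1 \<le> \<delta>"
    and bnd: "\<And>u. u < n \<Longrightarrow> \<delta> \<le> d u \<and> d u \<le> \<Delta>"
    and a: "a < n" "d a = \<delta>" and b: "b < n" "d b = \<Delta>"
  shows "\<exists>G :: nat pair_pre_digraph. nonempty_graph G \<and> min_degree G = \<delta> \<and> max_degree G = \<Delta> \<and>
    first_variable_zagreb \<alpha> G = (\<Sum>u<n. real (d u) powr (2 * \<alpha>))"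
proof (intro exI[of _ G] conjI)
  have "parcs G \<noteq> {}"
  proof
    assume "parcs G = {}"
    then have "vdegree G a = 0" by (simp add: vdegree_eq_card)
    with assms show False by (simp add: realizes_def)
  qed
  with G show "nonempty_graph G" by (simp add: nonempty_graph_def realizes_def)
  have im: "vdegree G ` pverts G = d ` {..<n}"
    using G by (auto simp: realizes_def)
  show "min_degree G = \<delta>" unfolding min_degree_def im
    using a bnd by (intro Min_eqI) auto
  show "max_degree G = \<Delta>" unfolding max_degree_def im
    using b bnd by (intro Max_eqI) auto
  show "first_variable_zagreb \<alpha> G = (\<Sum>u<n. real (d u) powr (2 * \<alpha>))"
    using G by (auto simp: first_variable_zagreb_def realizes_def intro!: sum.cong)
qed

text \<open>The perfect matching \<open>{1, 2}, {3, 4}, \<dots>\<close> of the positive integers.\<close>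

definition partner :: "nat \<Rightarrow> nat" where
  "partner u = (if odd u then u + 1 else u - 1)"

lemma partner_partner: "1 \<le> u \<Longrightarrow> partner (partner u) = u"
  by (auto simp: partner_def)

lemma partner_neq: "1 \<le> u \<Longrightarrow> partner u \<noteq> u"
  by (auto simp: partner_def)

text \<open>Evenness prevents the last element \<open>m\<close> from being matched with
  \<open>m + 1\<close>.\<close>

lemma partner_in: "even m \<Longrightarrow> u \<in> {1..m} \<Longrightarrow> partner u \<in> {1..m}"
  by (auto simp: partner_def) presburger+

lemma exists_order_plus_1:
  fixes \<delta> \<Delta> :: nat
  assumes "1 \<le> \<delta>" "\<delta> < \<Delta>"
  shows "\<exists>G :: nat pair_pre_digraph. nonempty_graph G \<and> min_degree G = \<delta> \<and> max_degree G = \<Delta> \<and>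
    first_variable_zagreb \<alpha> G = real \<delta> * real \<Delta> powr (2 * \<alpha>)
      + (real \<Delta> - real \<delta>) * (real \<Delta> - 1) powr (2 * \<alpha>) + real \<delta> powr (2 * \<alpha>)"
proof -
  have real_pred: "real (\<Delta> - 1) = real \<Delta> - 1" "real (\<Delta> - \<delta>) = real \<Delta> - real \<delta>"
    using assms by auto
  \<comment> \<open>The complement is a star with centre 0 and leaves \<delta> + 1, ..., \<Delta>;
    the vertices 1, ..., \<delta> are isolated in it and so have full degree \<Delta>.\<close>
  define N where "N u = (if u = 0 then {\<delta>+1..\<Delta>} else if u \<le> \<delta> then {} else {0})" for u :: nat
  define d where "d u = (if u = 0 then \<delta> else if u \<le> \<delta> then \<Delta> else \<Delta> - 1)" for u :: nat
  obtain G where G: "realizes G (\<Delta> + 1) d"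
  proof (rule complement_realizes[of "\<Delta> + 1" N d])
    show "N u \<subseteq> {..<\<Delta> + 1} - {u}" if "u < \<Delta> + 1" for u
      using assms that by (auto simp: N_def split: if_splits)
    show "u \<in> N v" if "u < \<Delta> + 1" "v \<in> N u" for u v
      using assms that by (auto simp: N_def split: if_splits)
    show "d u + card (N u) + 1 = \<Delta> + 1" if "u < \<Delta> + 1" for u
      using assms that by (auto simp: N_def d_def)
  qed
  have ex: "\<exists>G :: nat pair_pre_digraph. nonempty_graph G \<and> min_degree G = \<delta> \<and> max_degree G = \<Delta> \<and>
      first_variable_zagreb \<alpha> G = (\<Sum>u<\<Delta> + 1. real (d u) powr (2 * \<alpha>))"
    using assms by (intro realizes_imp_exists[OF G, of _ _ 0 1]) (auto simp: d_def)
  have "(\<Sum>u<\<Delta> + 1. real (d u) powr (2 * \<alpha>))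
      = real \<delta> powr (2 * \<alpha>) + (\<Sum>u<\<Delta>. real (d (Suc u)) powr (2 * \<alpha>))"
    by (simp add: sum.lessThan_Suc_shift d_def del: sum.lessThan_Suc)
  \<comment> \<open>After the shift, \<open>Suc u \<le> \<delta>\<close> means
    \<open>u < \<delta>\<close>, so the cut at \<delta> separates the degrees \<Delta> and \<Delta>
    - 1.\<close>
  also have "(\<Sum>u<\<Delta>. real (d (Suc u)) powr (2 * \<alpha>))
      = (\<Sum>u<\<delta>. real (d (Suc u)) powr (2 * \<alpha>)) + (\<Sum>u\<in>{\<delta>..<\<Delta>}. real (d (Suc u)) powr (2 * \<alpha>))"
    using assms by (simp add: sum.atLeastLessThan_concat lessThan_atLeast0)
  also have "\<dots> = real \<delta> * real \<Delta> powr (2 * \<alpha>) + real (\<Delta> - \<delta>) * real (\<Delta> - 1) powr (2 * \<alpha>)"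
    using assms by (simp add: d_def of_nat_diff)
  finally show ?thesis
    using ex real_pred by (simp only: ac_simps)
qed

lemma exists_order_plus_2_regular:
  fixes \<delta> \<Delta> :: nat
  assumes "1 \<le> \<delta>" "\<delta> < \<Delta>" "even \<delta>"
  shows "\<exists>G :: nat pair_pre_digraph. nonempty_graph G \<and> min_degree G = \<delta> \<and> max_degree G = \<Delta> \<and>
    first_variable_zagreb \<alpha> G = (real \<Delta> + 1) * real \<Delta> powr (2 * \<alpha>) + real \<delta> powr (2 * \<alpha>)"
proof -
  \<comment> \<open>In the complement, 0 is joined to \<delta> + 1, ..., \<Delta> + 1, and 1, ...,
    \<delta> carry a perfect matching, possible since \<delta> is even. Every vertex but 0 then has
    exactly one non-neighbour.\<close>
  define N where "N u = (if u = 0 then {\<delta>+1..\<Delta>+1} else if u \<le> \<delta> then {partner u} else {0})" for u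
  define d where "d u = (if u = 0 then \<delta> else \<Delta>)" for u :: nat
  have p: "1 \<le> partner u \<and> partner u \<le> \<delta> \<and> partner u \<noteq> u \<and> partner (partner u) = u"
    if "1 \<le> u" "u \<le> \<delta>" for u
    using partner_in[OF assms(3), of u] partner_neq[of u] partner_partner[of u] that by auto
  obtain G where G: "realizes G (\<Delta> + 2) d"
  proof (rule complement_realizes[of "\<Delta> + 2" N d])
    show "N u \<subseteq> {..<\<Delta> + 2} - {u}" if "u < \<Delta> + 2" for u
      using assms that p[of u] by (auto simp: N_def split: if_splits)
    show "u \<in> N v" if "u < \<Delta> + 2" "v \<in> N u" for u v
      using assms that p[of u] by (auto simp: N_def split: if_splits)
    show "d u + card (N u) + 1 = \<Delta> + 2" if "u < \<Delta> + 2" for u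
      using assms that by (auto simp: N_def d_def)
  qed
  have ex: "\<exists>G :: nat pair_pre_digraph. nonempty_graph G \<and> min_degree G = \<delta> \<and> max_degree G = \<Delta> \<and>
      first_variable_zagreb \<alpha> G = (\<Sum>u<\<Delta> + 2. real (d u) powr (2 * \<alpha>))"
    using assms by (intro realizes_imp_exists[OF G, of _ _ 0 1]) (auto simp: d_def)
  have "(\<Sum>u<\<Delta> + 2. real (d u) powr (2 * \<alpha>))
      = real \<delta> powr (2 * \<alpha>) + (\<Sum>u<\<Delta> + 1. real (d (Suc u)) powr (2 * \<alpha>))"
    using sum.lessThan_Suc_shift[of "\<lambda>u. real (d u) powr (2 * \<alpha>)" "\<Delta> + 1"] by (simp add: d_def)
  also have "\<dots> = (real \<Delta> + 1) * real \<Delta> powr (2 * \<alpha>) + real \<delta> powr (2 * \<alpha>)"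
    by (simp add: d_def algebra_simps)
  finally show ?thesis
    using ex by (simp only:)
qed

text \<open>Attains \<open>zagreb_ge_parity\<close> with \<open>k = \<Delta>\<close>. An odd
  \<delta> leaves one of the vertices 1, ..., \<delta> unmatched; its complement edge goes to a leaf
  of 0, which loses one degree.\<close>

lemma exists_order_plus_2_deficient:
  fixes \<delta> \<Delta> :: nat
  assumes "1 \<le> \<delta>" "\<delta> < \<Delta>" "odd \<delta>"
  shows "\<exists>G :: nat pair_pre_digraph. nonempty_graph G \<and> min_degree G = \<delta> \<and> max_degree G = \<Delta> \<and>
    first_variable_zagreb \<alpha> G
      = real \<Delta> powr (2 * \<alpha> + 1) + (real \<Delta> - 1) powr (2 * \<alpha>) + real \<delta> powr (2 * \<alpha>)"
proof -
  have real_pred: "real (\<Delta> - 1) = real \<Delta> - 1"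
    using assms by auto
  \<comment> \<open>complement: vertex 0 joined to \<open>\<delta> + 1, \<dots>, \<Delta> + 1\<close>, a perfect matching on \<open>1, \<dots>, \<delta> - 1\<close>, and the
    edge \<open>{\<delta>, \<Delta> + 1}\<close>, which makes \<open>\<Delta> + 1\<close> the deficient vertex\<close>
  define N where "N u = (if u = 0 then {\<delta>+1..\<Delta>+1} else if u < \<delta> then {partner u}
    else if u = \<delta> then {\<Delta>+1} else if u \<le> \<Delta> then {0} else {0, \<delta>})" for u
  define d where "d u = (if u = 0 then \<delta> else if u \<le> \<Delta> then \<Delta> else \<Delta> - 1)" for u :: nat
  have p: "1 \<le> partner u \<and> partner u < \<delta> \<and> partner u \<noteq> u \<and> partner (partner u) = u"
    if "1 \<le> u" "u < \<delta>" for u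
    using partner_in[of "\<delta> - 1" u] partner_neq[of u] partner_partner[of u] that assms by force
  obtain G where G: "realizes G (\<Delta> + 2) d"
  proof (rule complement_realizes[of "\<Delta> + 2" N d])
    show "N u \<subseteq> {..<\<Delta> + 2} - {u}" if "u < \<Delta> + 2" for u
      using assms that p[of u] by (auto simp: N_def split: if_splits)
    show "u \<in> N v" if "u < \<Delta> + 2" "v \<in> N u" for u v
      using assms that p[of u] by (auto simp: N_def split: if_splits)
    show "d u + card (N u) + 1 = \<Delta> + 2" if "u < \<Delta> + 2" for u
      using assms that by (auto simp: N_def d_def)
  qed
  have ex: "\<exists>G :: nat pair_pre_digraph. nonempty_graph G \<and> min_degree G = \<delta> \<and> max_degree G = \<Delta> \<and>
      first_variable_zagreb \<alpha> G = (\<Sum>u<\<Delta> + 2. real (d u) powr (2 * \<alpha>))"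
    using assms by (intro realizes_imp_exists[OF G, of _ _ 0 1]) (auto simp: d_def)
  have "(\<Sum>u<\<Delta> + 2. real (d u) powr (2 * \<alpha>))
      = real \<delta> powr (2 * \<alpha>) + (\<Sum>u<\<Delta> + 1. real (d (Suc u)) powr (2 * \<alpha>))"
    using sum.lessThan_Suc_shift[of "\<lambda>u. real (d u) powr (2 * \<alpha>)" "\<Delta> + 1"] by (simp add: d_def)
  also have "\<dots> = real \<Delta> * real \<Delta> powr (2 * \<alpha>) + real (\<Delta> - 1) powr (2 * \<alpha>) + real \<delta> powr (2 * \<alpha>)"
    by (simp add: d_def)
  also have "real \<Delta> * real \<Delta> powr (2 * \<alpha>) = real \<Delta> powr (2 * \<alpha> + 1)"
    using assms by (simp add: powr_add)
  finally show ?thesis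
    using ex real_pred by (simp only:)
qed

text \<open>For odd \<delta> and \<Delta>, order \<Delta> + 2 with all other degrees \<Delta> would
  give an odd degree sum. With one more vertex, every vertex but 0 needs complement degree
  2.\<close>

lemma exists_order_plus_3:
  fixes \<delta> \<Delta> :: nat
  assumes "1 \<le> \<delta>" "\<delta> < \<Delta>" "odd \<delta>" "odd \<Delta>"
  shows "\<exists>G :: nat pair_pre_digraph. nonempty_graph G \<and> min_degree G = \<delta> \<and> max_degree G = \<Delta> \<and>
    first_variable_zagreb \<alpha> G = (real \<Delta> + 2) * real \<Delta> powr (2 * \<alpha>) + real \<delta> powr (2 * \<alpha>)"
proof -
  \<comment> \<open>Vertex 0 needs complement degree \<open>\<Delta> + 2 - \<delta> = m + 2\<close>.
    As a difference of odd numbers \<open>m\<close> is even, so 1, ..., \<open>m\<close> can be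
    matched.\<close>
  define m where "m = \<Delta> - \<delta>"
  have m: "even m" "m + \<delta> = \<Delta>" "0 < m" using assms by (auto simp: m_def)
  \<comment> \<open>complement: vertex 0 joined to \<open>1, \<dots>, m + 1\<close> and \<open>\<Delta> + 2\<close>, a perfect matching on \<open>1, \<dots>, m\<close>, and the
    path \<open>m + 1, \<dots>, \<Delta> + 2\<close>\<close>
  define N where "N u = (if u = 0 then insert (\<Delta>+2) {1..m+1} else if u \<le> m then {0, partner u}
    else if u = m + 1 then {0, m+2} else if u \<le> \<Delta> + 1 then {u-1, u+1} else {0, \<Delta>+1})" for u
  define d where "d u = (if u = 0 then \<delta> else \<Delta>)" for u :: nat
  have p: "1 \<le> partner u \<and> partner u \<le> m \<and> partner u \<noteq> u \<and> partner (partner u) = u"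
    if "1 \<le> u" "u \<le> m" for u
    using partner_in[OF m(1), of u] partner_neq[of u] partner_partner[of u] that by auto
  have N: "N 0 = insert (Suc (Suc \<Delta>)) {Suc 0..Suc m}"
    "\<And>u. 0 < u \<Longrightarrow> u \<le> m \<Longrightarrow> N u = {0, partner u}"
    "N (Suc m) = {0, Suc (Suc m)}"
    "\<And>u. Suc m < u \<Longrightarrow> u \<le> Suc \<Delta> \<Longrightarrow> N u = {u - Suc 0, Suc u}"
    "N (Suc (Suc \<Delta>)) = {0, Suc \<Delta>}"
    using m by (auto simp: N_def)
  \<comment> \<open>Since \<delta> is positive, the path from \<open>m + 1\<close> to \<Delta> + 2
    has an interior vertex, so its two ends are not adjacent in the complement.\<close>
  have le: "m + 1 \<le> \<Delta>" using m assms by linarith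
  have cases: P if "u < \<Delta> + 3" "u = 0 \<Longrightarrow> P" "1 \<le> u \<Longrightarrow> u \<le> m \<Longrightarrow> P" "u = m + 1 \<Longrightarrow> P"
    "m + 2 \<le> u \<Longrightarrow> u \<le> \<Delta> + 1 \<Longrightarrow> P" "u = \<Delta> + 2 \<Longrightarrow> P" for u P
    using that by linarith
  obtain G where G: "realizes G (\<Delta> + 3) d"
  proof (rule complement_realizes[of "\<Delta> + 3" N d])
    show "N u \<subseteq> {..<\<Delta> + 3} - {u}" if "u < \<Delta> + 3" for u
      by (rule cases[OF that]) (use le p[of u] in \<open>auto simp: N\<close>)
    show "u \<in> N v" if u: "u < \<Delta> + 3" and v: "v \<in> N u" for u v
    proof (rule cases[OF u])
      assume "u = 0"
      then have "v = \<Delta> + 2 \<or> v = m + 1 \<or> 1 \<le> v \<and> v \<le> m" using v N(1) by auto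
      then show ?thesis using \<open>u = 0\<close> N by auto
    next
      assume "1 \<le> u" "u \<le> m"
      then show ?thesis using v p[of u] N(2)[of u] N(1) N(2)[of "partner u"] by auto
    next
      assume "u = m + 1"
      then show ?thesis using v le by (auto simp: N)
    next
      assume u: "m + 2 \<le> u" "u \<le> \<Delta> + 1"
      then have "N u = {u - 1, u + 1}" by (simp add: N(4))
      \<comment> \<open>A path neighbour of \<open>u\<close> may be an end of the path, where
        \<open>N\<close> has a different form; hence the four cases.\<close>
      with v consider "v = u - 1" "u = m + 2" | "v = u - 1" "m + 2 < u"
        | "v = u + 1" "u = \<Delta> + 1" | "v = u + 1" "u < \<Delta> + 1"
        using u by (metis insertE singletonD le_neq_implies_less)
      then show ?thesis
      proof cases
        case 1
        then show ?thesis by (simp add: N(3))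
      next
        case 2
        then show ?thesis using u N(4)[of v] by simp
      next
        case 3
        then show ?thesis by (simp add: N(5))
      next
        case 4
        then show ?thesis using u N(4)[of v] by simp
      qed
    next
      assume u: "u = \<Delta> + 2"
      then have "v = 0 \<or> v = Suc \<Delta>" using v by (simp add: N)
      moreover have "N (Suc \<Delta>) = {\<Delta>, Suc (Suc \<Delta>)}" using N(4)[of "Suc \<Delta>"] le by simp
      ultimately show ?thesis using u by (elim disjE) (simp_all add: N(1))
    qed
    show "d u + card (N u) + 1 = \<Delta> + 3" if u: "u < \<Delta> + 3" for u
      by (rule cases[OF u]) (use le m p[of u] in \<open>simp_all add: N d_def\<close>)
  qed
  have ex: "\<exists>G :: nat pair_pre_digraph. nonempty_graph G \<and> min_degree G = \<delta> \<and> max_degree G = \<Delta> \<and>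
      first_variable_zagreb \<alpha> G = (\<Sum>u<\<Delta> + 3. real (d u) powr (2 * \<alpha>))"
    using assms by (intro realizes_imp_exists[OF G, of _ _ 0 1]) (auto simp: d_def)
  have "(\<Sum>u<\<Delta> + 3. real (d u) powr (2 * \<alpha>))
      = real \<delta> powr (2 * \<alpha>) + (\<Sum>u<\<Delta> + 2. real (d (Suc u)) powr (2 * \<alpha>))"
    using sum.lessThan_Suc_shift[of "\<lambda>u. real (d u) powr (2 * \<alpha>)" "\<Delta> + 2"]
    by (simp add: d_def numeral_3_eq_3)
  also have "\<dots> = (real \<Delta> + 2) * real \<Delta> powr (2 * \<alpha>) + real \<delta> powr (2 * \<alpha>)"
    by (simp add: d_def algebra_simps)
  finally show ?thesis
    using ex by (simp only:)
qed

section \<open>Assembling the bounds and the extremal graphs\<close>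

lemma exists_min:
  fixes a b :: real
  assumes "\<exists>x. P x \<and> Q x \<and> R x \<and> g x = a" "\<exists>x. P x \<and> Q x \<and> R x \<and> g x = b"
  shows "\<exists>x. P x \<and> Q x \<and> R x \<and> g x = min a b"
  using assms by (cases "a \<le> b") auto

theorem theorem3p2:
  fixes \<alpha> :: real and \<delta> \<Delta> :: nat
  assumes "\<alpha> < 0" and "1 \<le> \<delta>" and "\<delta> < \<Delta>"
  shows "(even \<delta> \<longrightarrow>
      (let B = min (real \<delta> * real \<Delta> powr (2 * \<alpha>) + (real \<Delta> - real \<delta>) * (real \<Delta> - 1) powr (2 * \<alpha>)
                   + real \<delta> powr (2 * \<alpha>))
                   ((real \<Delta> + 1) * real \<Delta> powr (2 * \<alpha>) + real \<delta> powr (2 * \<alpha>))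
       in (\<forall>G :: 'a pair_pre_digraph.
             nonempty_graph G \<and> min_degree G = \<delta> \<and> max_degree G = \<Delta>
             \<longrightarrow> first_variable_zagreb \<alpha> G \<ge> B) \<and>
          (\<exists>G :: nat pair_pre_digraph.
             nonempty_graph G \<and> min_degree G = \<delta> \<and> max_degree G = \<Delta>
             \<and> first_variable_zagreb \<alpha> G = B))) \<and>
    ((odd \<delta> \<and> even \<Delta>) \<or>
       (odd (\<delta> * \<Delta>) \<and> 2 * real \<Delta> powr (2 * \<alpha>) > (real \<Delta> - 1) powr (2 * \<alpha>)) \<longrightarrow>
      (let B = min (real \<delta> * real \<Delta> powr (2 * \<alpha>) + (real \<Delta> - real \<delta>) * (real \<Delta> - 1) powr (2 * \<alpha>)
                   + real \<delta> powr (2 * \<alpha>))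
                   (real \<Delta> powr (2 * \<alpha> + 1) + (real \<Delta> - 1) powr (2 * \<alpha>) + real \<delta> powr (2 * \<alpha>))
       in (\<forall>G :: 'a pair_pre_digraph.
             nonempty_graph G \<and> min_degree G = \<delta> \<and> max_degree G = \<Delta>
             \<longrightarrow> first_variable_zagreb \<alpha> G \<ge> B) \<and>
          (\<exists>G :: nat pair_pre_digraph.
             nonempty_graph G \<and> min_degree G = \<delta> \<and> max_degree G = \<Delta>
             \<and> first_variable_zagreb \<alpha> G = B))) \<and>
    (odd (\<delta> * \<Delta>) \<and> 2 * real \<Delta> powr (2 * \<alpha>) \<le> (real \<Delta> - 1) powr (2 * \<alpha>) \<longrightarrow>
      (let B = min (real \<delta> * real \<Delta> powr (2 * \<alpha>) + (real \<Delta> - real \<delta>) * (real \<Delta> - 1) powr (2 * \<alpha>)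
                   + real \<delta> powr (2 * \<alpha>))
                   ((real \<Delta> + 2) * real \<Delta> powr (2 * \<alpha>) + real \<delta> powr (2 * \<alpha>))
       in (\<forall>G :: 'a pair_pre_digraph.
             nonempty_graph G \<and> min_degree G = \<delta> \<and> max_degree G = \<Delta>
             \<longrightarrow> first_variable_zagreb \<alpha> G \<ge> B) \<and>
          (\<exists>G :: nat pair_pre_digraph.
             nonempty_graph G \<and> min_degree G = \<delta> \<and> max_degree G = \<Delta>
             \<and> first_variable_zagreb \<alpha> G = B)))"
proof -
  have \<Delta>: "real (\<Delta> - 1) = real \<Delta> - 1"
    "real \<Delta> powr (2 * \<alpha> + 1) = real \<Delta> * real \<Delta> powr (2 * \<alpha>)"
    using assms by (auto simp: powr_add)
  have card_cases: "(card (pverts G) = \<Delta> + 1 \<Longrightarrow> P) \<Longrightarrow> (\<Delta> + 1 < card (pverts G) \<Longrightarrow> P) \<Longrightarrow> P"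
    if "nonempty_graph G" "min_degree G = \<delta>" "max_degree G = \<Delta>" for G :: "'a pair_pre_digraph" and P
    using max_degree_less_card[of \<alpha> \<delta> \<Delta> G] that assms by linarith
  show ?thesis
    unfolding Let_def
  proof (intro conjI impI allI; (elim conjE)?)
    fix G :: "'a pair_pre_digraph"
    assume "even \<delta>" and G: "nonempty_graph G" "min_degree G = \<delta>" "max_degree G = \<Delta>"
    show "min (real \<delta> * real \<Delta> powr (2 * \<alpha>) + (real \<Delta> - real \<delta>) * (real \<Delta> - 1) powr (2 * \<alpha>)
          + real \<delta> powr (2 * \<alpha>))
        ((real \<Delta> + 1) * real \<Delta> powr (2 * \<alpha>) + real \<delta> powr (2 * \<alpha>)) \<le> first_variable_zagreb \<alpha> G"
      by (rule card_cases[OF G]) (use zagreb_ge_card_eq[of \<alpha> \<delta> \<Delta> G]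
          zagreb_ge_card[of \<alpha> \<delta> \<Delta> G "\<Delta> + 1"] G assms \<Delta>
        in \<open>auto simp: min_le_iff_disj algebra_simps\<close>)
  next
    fix G :: "'a pair_pre_digraph"
    assume par: "odd \<delta> \<and> even \<Delta> \<or> odd (\<delta> * \<Delta>) \<and> (real \<Delta> - 1) powr (2 * \<alpha>) < 2 * real \<Delta> powr (2 * \<alpha>)"
      and G: "nonempty_graph G" "min_degree G = \<delta>" "max_degree G = \<Delta>"
    have "odd \<delta>" using par by auto
    have bound: "real \<Delta> * real \<Delta> powr (2 * \<alpha>) + (real \<Delta> - 1) powr (2 * \<alpha>) + real \<delta> powr (2 * \<alpha>)
        \<le> first_variable_zagreb \<alpha> G" if c: "\<Delta> + 1 < card (pverts G)"
    proof (cases "even \<Delta> \<or> odd (card (pverts G))")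
      case True
      then show ?thesis
        using zagreb_ge_parity[of \<alpha> \<delta> \<Delta> G \<Delta>] G assms \<Delta> c \<open>odd \<delta>\<close> by simp
    next
      \<comment> \<open>Here \<Delta> is odd and the order even, so the order is at least \<Delta> +
        3. The strict hypothesis in \<open>par\<close> makes two extra terms
        \<open>real \<Delta> powr (2 * \<alpha>)\<close> exceed the one term for \<Delta> -
        1.\<close>
      case False
      then have "\<Delta> + 2 \<noteq> card (pverts G)" by (metis even_add even_numeral)
      then have "\<Delta> + 2 < card (pverts G)" using c by linarith
      then show ?thesis
        using zagreb_ge_card[of \<alpha> \<delta> \<Delta> G "\<Delta> + 2"] G assms par False by (auto simp: algebra_simps)
    qed
    show "min (real \<delta> * real \<Delta> powr (2 * \<alpha>) + (real \<Delta> - real \<delta>) * (real \<Delta> - 1) powr (2 * \<alpha>)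
          + real \<delta> powr (2 * \<alpha>))
        (real \<Delta> powr (2 * \<alpha> + 1) + (real \<Delta> - 1) powr (2 * \<alpha>) + real \<delta> powr (2 * \<alpha>))
        \<le> first_variable_zagreb \<alpha> G"
      by (rule card_cases[OF G]) (use bound zagreb_ge_card_eq[of \<alpha> \<delta> \<Delta> G] G assms \<Delta>
        in \<open>auto simp: min_le_iff_disj\<close>)
  next
    fix G :: "'a pair_pre_digraph"
    assume odd: "odd (\<delta> * \<Delta>)" and le: "2 * real \<Delta> powr (2 * \<alpha>) \<le> (real \<Delta> - 1) powr (2 * \<alpha>)"
      and G: "nonempty_graph G" "min_degree G = \<delta>" "max_degree G = \<Delta>"
    have bound: "(real \<Delta> + 2) * real \<Delta> powr (2 * \<alpha>) + real \<delta> powr (2 * \<alpha>)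
        \<le> first_variable_zagreb \<alpha> G" if c: "\<Delta> + 1 < card (pverts G)"
    proof (cases "card (pverts G) = \<Delta> + 2")
      case True
      \<comment> \<open>At this order parity forces a deficient vertex, and by \<open>le\<close> its
        term is at least twice the term for \<Delta>, which gives the factor \<Delta> + 2.\<close>
      then have "odd (card (pverts G))" using odd by simp
      then show ?thesis
        using zagreb_ge_parity[of \<alpha> \<delta> \<Delta> G \<Delta>] G assms \<Delta> c odd le by (simp add: algebra_simps)
    next
      case False
      then have "\<Delta> + 2 < card (pverts G)" using c by linarith
      then show ?thesis
        using zagreb_ge_card[of \<alpha> \<delta> \<Delta> G "\<Delta> + 2"] G assms by (simp add: algebra_simps)
    qed
    show "min (real \<delta> * real \<Delta> powr (2 * \<alpha>) + (real \<Delta> - real \<delta>) * (real \<Delta> - 1) powr (2 * \<alpha>)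
          + real \<delta> powr (2 * \<alpha>))
        ((real \<Delta> + 2) * real \<Delta> powr (2 * \<alpha>) + real \<delta> powr (2 * \<alpha>)) \<le> first_variable_zagreb \<alpha> G"
      by (rule card_cases[OF G]) (use bound zagreb_ge_card_eq[of \<alpha> \<delta> \<Delta> G] G assms \<Delta>
        in \<open>auto simp: min_le_iff_disj\<close>)
  \<comment> \<open>The sharpness claims remain. Each term of each minimum is attained by a
    constructed graph, and the minimum equals one of its two terms.\<close>
  qed (use assms in \<open>auto intro!: exists_min exists_order_plus_1 exists_order_plus_2_regular
      exists_order_plus_2_deficient exists_order_plus_3\<close>)
qed

end
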